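(* Let $Y$ be a metric space, $Z\subseteq Y$ a subset with the restricted metric, and $i:Z\to Y$ the inclusion. Then the induced map $\mathcal E(i):\mathcal E(Z)\to\mathcal E(Y)$, $[\varphi]\mapsto[i\circ\varphi]$, is a uniform embedding (a uniform isomorphism onto its image equipped with the subspace uniformity).
   Context: Metrics are finite-valued. Let $(X,d)$ be a metric space. A subset $E\subseteq X\times X$ is an entourage of $X$ if $\sup_{(x,y)\in E}d(x,y)<\infty$; $B\subseteq X$ is bounded if $B\times B$ is an entourage. A subset $C\subseteq X\times X$ is a coentourage if every sequence $(x_i,y_i)_i$ in $C$ is either bounded (both $(x_i)_i$ and $(y_i)_i$ are bounded) or the set of values $d(x_i,y_i)$ is unbounded; equivalently, for every entourage $E$ there is a bounded set $B$ with $E\cap C\subseteq B\times B$. For an entourage $E$ and $A\subseteq X$ put $E[A]=\{x\in X:\exists a\in A,\ (x,a)\in E\}$. Two subsets $A,B\subseteq X$ are close if $A\times B$ is not a coentourage. A map $f:X\to Y$ of metric spaces is coarse if $(f\times f)(E)$ is an entourage of $Y$ for every entourage $E$ of $X$, and $f^{-1}(B)$ is bounded for every bounded $B\subseteq Y$. A coarse cover of $X$ is a finite family $\mathcal U=(U_i)_i$ of subsets of $X$ such that $(X\times X)\setminus\bigcup_i (U_i\times U_i)$ is a coentourage. For $S\subseteq X$ the coarse star is $\mathrm{cst}(S,\mathcal U)=\bigcup\{U_i: S \text{ is close to } U_i\}$. Let $\mathbb Z_+$ be the non-negative integers with the standard metric. The set $\mathcal E(X)$ consists of endpoints: equivalence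 classes $[\phi]$ of coarse maps $\phi:\mathbb Z_+\to X$, where $\phi$ and $\psi$ are equivalent if $\phi(\mathbb Z_+)$ and $\psi(\mathbb Z_+)$ have finite Hausdorff distance. For a coarse cover $\mathcal U$ and endpoints $p=[\phi]$, $q=[\psi]$ write $q\in\mathcal U[p]$ if there is an entourage $E$ of $X$ with $\psi(\mathbb Z_+)\subseteq E[\mathrm{cst}(\phi(\mathbb Z_+),\mathcal U)]$ and $\phi(\mathbb Z_+)\subseteq E[\mathrm{cst}(\psi(\mathbb Z_+),\mathcal U)]$. The uniformity on $\mathcal E(X)$ has as base the sets $D_{\mathcal U}=\{(p,q): q\in\mathcal U[p]\}$, with $\mathcal U$ ranging over all coarse covers of $X$. *)

theory Defs
  imports "HOL-Analysis.Analysis"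
begin

section \<open>Entourages, coentourages, closeness\<close>

definition entourage :: "'a metric \<Rightarrow> ('a \<times> 'a) set \<Rightarrow> bool" where
  "entourage X E \<longleftrightarrow>
     E \<subseteq> mspace X \<times> mspace X \<and> bdd_above ((\<lambda>(x, y). mdist X x y) ` E)"

definition coarse_bounded :: "'a metric \<Rightarrow> 'a set \<Rightarrow> bool" where
  "coarse_bounded X B \<longleftrightarrow> B \<subseteq> mspace X \<and> entourage X (B \<times> B)"

definition coentourage :: "'a metric \<Rightarrow> ('a \<times> 'a) set \<Rightarrow> bool" where
  "coentourage X C \<longleftrightarrow>
     C \<subseteq> mspace X \<times> mspace X \<and>
     (\<forall>x y :: nat \<Rightarrow> 'a. (\<forall>i. (x i, y i) \<in> C) \<longrightarrow>
        (coarse_bounded X (range x) \<and> coarse_bounded X (range y)) \<or>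
        \<not> bdd_above (range (\<lambda>i. mdist X (x i) (y i))))"

text \<open>The set \<open>E[A]\<close>. The point of \<open>A\<close> is the \<^emph>\<open>second\<close> component of the pair,
  so this is the image of \<open>A\<close> under the converse of \<open>E\<close>.\<close>

definition thickening :: "'a metric \<Rightarrow> ('a \<times> 'a) set \<Rightarrow> 'a set \<Rightarrow> 'a set" where
  "thickening X E A = {x \<in> mspace X. \<exists>a\<in>A. (x, a) \<in> E}"

definition close_sets :: "'a metric \<Rightarrow> 'a set \<Rightarrow> 'a set \<Rightarrow> bool" where
  "close_sets X A B \<longleftrightarrow>
     A \<subseteq> mspace X \<and> B \<subseteq> mspace X \<and> \<not> coentourage X (A \<times> B)"


section \<open>Coarse maps and coarse covers\<close>

definition coarse_map :: "'a metric \<Rightarrow> 'b metric \<Rightarrow> ('a \<Rightarrow> 'b) \<Rightarrow> bool" where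
  "coarse_map X Y f \<longleftrightarrow>
     f ` mspace X \<subseteq> mspace Y \<and>
     (\<forall>E. entourage X E \<longrightarrow> entourage Y (map_prod f f ` E)) \<and>
     (\<forall>B. coarse_bounded Y B \<longrightarrow> coarse_bounded X (f -` B \<inter> mspace X))"

text \<open>A finite family of subsets is represented by the finite set of its members;
  repetitions and the choice of the index set play no role below. The members need
  not cover \<open>X\<close> in the set-theoretic sense.\<close>

definition coarse_cover :: "'a metric \<Rightarrow> 'a set set \<Rightarrow> bool" where
  "coarse_cover X \<U> \<longleftrightarrow>
     finite \<U> \<and> (\<forall>U\<in>\<U>. U \<subseteq> mspace X) \<and>
     coentourage X (mspace X \<times> mspace X - (\<Union>U\<in>\<U>. U \<times> U))"

definition coarse_star :: "'a metric \<Rightarrow> 'a set \<Rightarrow> 'a set set \<Rightarrow> 'a set" where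
  "coarse_star X S \<U> = \<Union>{U \<in> \<U>. close_sets X S U}"


section \<open>The space of endpoints\<close>

text \<open>The half-line of non-negative integers; the library has no metric on \<^typ>\<open>nat\<close>.\<close>

definition nat_metric :: "nat metric" where
  "nat_metric = metric (UNIV, \<lambda>m n. \<bar>real m - real n\<bar>)"

definition hausdorff_distance :: "'a metric \<Rightarrow> 'a set \<Rightarrow> 'a set \<Rightarrow> ennreal" where
  "hausdorff_distance X A B =
     max (SUP a\<in>A. INF b\<in>B. ennreal (mdist X a b))
         (SUP b\<in>B. INF a\<in>A. ennreal (mdist X a b))"

definition endpoint_rel :: "'a metric \<Rightarrow> ((nat \<Rightarrow> 'a) \<times> (nat \<Rightarrow> 'a)) set" where
  "endpoint_rel X =
     {(\<phi>, \<psi>). coarse_map nat_metric X \<phi> \<and> coarse_map nat_metric X \<psi> \<and>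
              hausdorff_distance X (range \<phi>) (range \<psi>) < \<infinity>}"

definition endpoints :: "'a metric \<Rightarrow> (nat \<Rightarrow> 'a) set set" where
  "endpoints X = {\<phi>. coarse_map nat_metric X \<phi>} // endpoint_rel X"

definition cover_close ::
    "'a metric \<Rightarrow> 'a set set \<Rightarrow> (nat \<Rightarrow> 'a) \<Rightarrow> (nat \<Rightarrow> 'a) \<Rightarrow> bool" where
  "cover_close X \<U> \<phi> \<psi> \<longleftrightarrow>
     (\<exists>E. entourage X E \<and>
          range \<psi> \<subseteq> thickening X E (coarse_star X (range \<phi>) \<U>) \<and>
          range \<phi> \<subseteq> thickening X E (coarse_star X (range \<psi>) \<U>))"

text \<open>The set \<open>D\<^sub>\<U>\<close>. By \<open>cover_relation_class\<close> below the choice of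
  representatives is immaterial.\<close>

definition cover_relation ::
    "'a metric \<Rightarrow> 'a set set \<Rightarrow> ((nat \<Rightarrow> 'a) set \<times> (nat \<Rightarrow> 'a) set) set" where
  "cover_relation X \<U> =
     {(p, q) \<in> endpoints X \<times> endpoints X. \<exists>\<phi>\<in>p. \<exists>\<psi>\<in>q. cover_close X \<U> \<phi> \<psi>}"

definition endpoint_uniformity ::
    "'a metric \<Rightarrow> ((nat \<Rightarrow> 'a) set \<times> (nat \<Rightarrow> 'a) set) set set" where
  "endpoint_uniformity X =
     {R. R \<subseteq> endpoints X \<times> endpoints X \<and>
         (\<exists>\<U>. coarse_cover X \<U> \<and> cover_relation X \<U> \<subseteq> R)}"

text \<open>The map induced by a coarse map \<open>f\<close> into \<open>Y\<close>; by \<open>endpoint_map_class\<close>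
  below it sends the class of \<open>\<phi>\<close> to the class of \<open>f \<circ> \<phi>\<close>.\<close>

definition endpoint_map ::
    "'b metric \<Rightarrow> ('a \<Rightarrow> 'b) \<Rightarrow> (nat \<Rightarrow> 'a) set \<Rightarrow> (nat \<Rightarrow> 'b) set" where
  "endpoint_map Y f p = (\<Union>\<phi>\<in>p. endpoint_rel Y `` {f \<circ> \<phi>})"


section \<open>Uniform embeddings\<close>

text \<open>The type class \<^class>\<open>uniform_space\<close> does not apply, because the underlying set
  \<open>endpoints X\<close> depends on the value \<open>X\<close>. Here a uniformity on a set \<open>A\<close> is the set of its
  entourages, which are subsets of \<open>A \<times> A\<close>.\<close>

definition uniformly_continuous_between ::
    "'a set \<Rightarrow> ('a \<times> 'a) set set \<Rightarrow> 'b set \<Rightarrow> ('b \<times> 'b) set set \<Rightarrow> ('a \<Rightarrow> 'b) \<Rightarrow> bool" where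
  "uniformly_continuous_between A \<A> B \<B> f \<longleftrightarrow>
     f ` A \<subseteq> B \<and> (\<forall>R\<in>\<B>. {(p, q) \<in> A \<times> A. (f p, f q) \<in> R} \<in> \<A>)"

definition uniform_isomorphism ::
    "'a set \<Rightarrow> ('a \<times> 'a) set set \<Rightarrow> 'b set \<Rightarrow> ('b \<times> 'b) set set \<Rightarrow> ('a \<Rightarrow> 'b) \<Rightarrow> bool" where
  "uniform_isomorphism A \<A> B \<B> f \<longleftrightarrow>
     bij_betw f A B \<and>
     uniformly_continuous_between A \<A> B \<B> f \<and>
     uniformly_continuous_between B \<B> A \<A> (inv_into A f)"

definition subspace_uniformity :: "('a \<times> 'a) set set \<Rightarrow> 'a set \<Rightarrow> ('a \<times> 'a) set set" where
  "subspace_uniformity \<A> S = (\<lambda>R. R \<inter> S \<times> S) ` \<A>"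

definition uniform_embedding ::
    "'a set \<Rightarrow> ('a \<times> 'a) set set \<Rightarrow> 'b set \<Rightarrow> ('b \<times> 'b) set set \<Rightarrow> ('a \<Rightarrow> 'b) \<Rightarrow> bool" where
  "uniform_embedding A \<A> B \<B> f \<longleftrightarrow>
     f ` A \<subseteq> B \<and> uniform_isomorphism A \<A> (f ` A) (subspace_uniformity \<B> (f ` A)) f"


section \<open>Basic facts\<close>

lemma Metric_space_nat: "Metric_space UNIV (\<lambda>m n. \<bar>real m - real n\<bar>)"
  by unfold_locales auto

lemma mspace_nat_metric [simp]: "mspace nat_metric = UNIV"
  by (simp add: nat_metric_def Metric_space.mspace_metric[OF Metric_space_nat])

lemma mdist_nat_metric [simp]: "mdist nat_metric m n = \<bar>real m - real n\<bar>"
  by (simp add: nat_metric_def Metric_space.mdist_metric[OF Metric_space_nat])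

lemma entourage_iff:
  "entourage X E \<longleftrightarrow>
     E \<subseteq> mspace X \<times> mspace X \<and> (\<exists>r. \<forall>x y. (x, y) \<in> E \<longrightarrow> mdist X x y \<le> r)"
  unfolding entourage_def bdd_above_def by (simp add: split_def) force

lemma coarse_bounded_iff_mbounded:
  "coarse_bounded X B \<longleftrightarrow> Metric_space.mbounded (mspace X) (mdist X) B"
  unfolding coarse_bounded_def entourage_iff
    Metric_space.mbounded_alt[OF Metric_space_mspace_mdist] by blast

lemma coarse_bounded_subset: "coarse_bounded X B \<Longrightarrow> A \<subseteq> B \<Longrightarrow> coarse_bounded X A"
  unfolding coarse_bounded_iff_mbounded
  by (rule Metric_space.mbounded_subset[OF Metric_space_mspace_mdist])

lemma coarse_bounded_Un:
  "coarse_bounded X (A \<union> B) \<longleftrightarrow> coarse_bounded X A \<and> coarse_bounded X B"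
  unfolding coarse_bounded_iff_mbounded
  by (rule Metric_space.mbounded_Un[OF Metric_space_mspace_mdist])

lemma coarse_bounded_nearby:
  assumes "coarse_bounded X B" "A \<subseteq> mspace X" "\<And>a. a \<in> A \<Longrightarrow> \<exists>b\<in>B. mdist X a b \<le> r"
  shows "coarse_bounded X A"
proof -
  interpret Metric_space "mspace X" "mdist X" by (rule Metric_space_mspace_mdist)
  have B: "mbounded B"
    using assms(1) by (simp add: coarse_bounded_iff_mbounded)
  then obtain R where R: "B \<subseteq> mspace X" "\<forall>x\<in>B. \<forall>y\<in>B. mdist X x y \<le> R"
    unfolding mbounded_alt by blast
  have "mdist X a a' \<le> r + R + r" if aa: "a \<in> A" "a' \<in> A" for a a'
  proof -
    obtain b b' where b: "b \<in> B" "mdist X a b \<le> r" "b' \<in> B" "mdist X a' b' \<le> r"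
      using assms(3)[OF aa(1)] assms(3)[OF aa(2)] by blast
    have mem: "a \<in> mspace X" "a' \<in> mspace X" "b \<in> mspace X" "b' \<in> mspace X"
      using aa b R(1) assms(2) by auto
    have "mdist X a a' \<le> mdist X a b + mdist X b a'" using mem by (simp add: triangle)
    also have "mdist X b a' \<le> mdist X b b' + mdist X b' a'" using mem by (simp add: triangle)
    finally show ?thesis using b R(2)[rule_format, of b b'] commute[of a' b'] by linarith
  qed
  then show ?thesis
    using assms(2) by (auto simp: coarse_bounded_iff_mbounded mbounded_alt)
qed

lemma coentourage_iff:
  "coentourage X C \<longleftrightarrow>
     C \<subseteq> mspace X \<times> mspace X \<and>
     (\<forall>E. entourage X E \<longrightarrow> (\<exists>B. coarse_bounded X B \<and> E \<inter> C \<subseteq> B \<times> B))"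
proof (intro iffI conjI allI impI; (elim conjE)?)
  show "C \<subseteq> mspace X \<times> mspace X" if "coentourage X C"
    using that by (simp add: coentourage_def)
next
  fix E assume C: "coentourage X C" and E: "entourage X E"
  interpret Metric_space "mspace X" "mdist X" by (rule Metric_space_mspace_mdist)
  obtain r where r: "\<And>x y. (x, y) \<in> E \<Longrightarrow> mdist X x y \<le> r"
    using E by (auto simp: entourage_iff)
  have EM: "E \<subseteq> mspace X \<times> mspace X" using E by (simp add: entourage_def)
  have fst_bd: "coarse_bounded X (fst ` (E \<inter> C))"
  proof (cases "E \<inter> C = {}")
    case True
    then show ?thesis by (simp add: coarse_bounded_iff_mbounded)
  next
    case False
    then obtain a b where ab: "(a, b) \<in> E \<inter> C" by auto
    show ?thesis
    proof (rule ccontr)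
      assume "\<not> ?thesis"
      then have "\<not> mbounded (fst ` (E \<inter> C))" by (simp add: coarse_bounded_iff_mbounded)
      moreover have aM: "a \<in> mspace X" using ab EM by auto
      moreover have "fst ` (E \<inter> C) \<subseteq> mspace X" using EM by auto
      ultimately have "\<not> (\<forall>x\<in>fst ` (E \<inter> C). mdist X a x \<le> real n)" for n
        unfolding mbounded by blast
      then have "\<exists>z\<in>E \<inter> C. mdist X a (fst z) > real n" for n
        by (simp add: not_le)
      then obtain z where z: "\<And>n. z n \<in> E \<inter> C" "\<And>n::nat. mdist X a (fst (z n)) > real n"
        by metis
      have "bdd_above (range (\<lambda>i. mdist X (fst (z i)) (snd (z i))))"
        by (rule bdd_aboveI[of _ r]) (use z r in force)
      moreover have "\<forall>i. (fst (z i), snd (z i)) \<in> C" using z(1) by simp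
      ultimately have "coarse_bounded X (range (\<lambda>i. fst (z i)))"
        using C[unfolded coentourage_def, THEN conjunct2, rule_format,
            of "\<lambda>i. fst (z i)" "\<lambda>i. snd (z i)"] by blast
      then have "coarse_bounded X (insert a (range (\<lambda>i. fst (z i))))"
        using aM by (simp add: coarse_bounded_iff_mbounded mbounded_insert)
      then obtain R where R: "\<forall>x y. (x, y) \<in> insert a (range (\<lambda>i. fst (z i))) \<times>
            insert a (range (\<lambda>i. fst (z i))) \<longrightarrow> mdist X x y \<le> R"
        unfolding coarse_bounded_def entourage_iff by blast
      have "mdist X a (fst (z i)) \<le> R" for i by (rule R[rule_format]) auto
      moreover obtain n where "R \<le> real n" using real_arch_simple by blast
      ultimately show False using z(2)[of n] by (metis not_le order_trans)
    qed
  qed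
  have "coarse_bounded X (snd ` (E \<inter> C))"
  proof (rule coarse_bounded_nearby[OF fst_bd])
    show "snd ` (E \<inter> C) \<subseteq> mspace X" using EM by auto
    show "\<exists>b\<in>fst ` (E \<inter> C). mdist X y b \<le> r" if "y \<in> snd ` (E \<inter> C)" for y
      using that r commute by force
  qed
  with fst_bd have "coarse_bounded X (fst ` (E \<inter> C) \<union> snd ` (E \<inter> C))"
    by (simp add: coarse_bounded_Un)
  moreover have "E \<inter> C \<subseteq> (fst ` (E \<inter> C) \<union> snd ` (E \<inter> C)) \<times> (fst ` (E \<inter> C) \<union> snd ` (E \<inter> C))"
    by force
  ultimately show "\<exists>B. coarse_bounded X B \<and> E \<inter> C \<subseteq> B \<times> B" by blast
next
  assume CM: "C \<subseteq> mspace X \<times> mspace X"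
    and C: "\<forall>E. entourage X E \<longrightarrow> (\<exists>B. coarse_bounded X B \<and> E \<inter> C \<subseteq> B \<times> B)"
  show "coentourage X C"
    unfolding coentourage_def
  proof (intro conjI allI impI CM)
    fix x y :: "nat \<Rightarrow> 'a" assume xy: "\<forall>i. (x i, y i) \<in> C"
    show "(coarse_bounded X (range x) \<and> coarse_bounded X (range y)) \<or>
        \<not> bdd_above (range (\<lambda>i. mdist X (x i) (y i)))"
    proof (rule disjCI, simp)
      assume bd: "bdd_above (range (\<lambda>i. mdist X (x i) (y i)))"
      have "entourage X (range (\<lambda>i. (x i, y i)))"
        using bd xy CM by (auto simp: entourage_def image_image)
      then obtain B where B: "coarse_bounded X B" "range (\<lambda>i. (x i, y i)) \<inter> C \<subseteq> B \<times> B"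
        using C by blast
      have "range x \<subseteq> B" "range y \<subseteq> B" using B(2) xy by auto
      then show "coarse_bounded X (range x) \<and> coarse_bounded X (range y)"
        using B(1) coarse_bounded_subset by blast
    qed
  qed
qed

lemma one_sided_hausdorff_finite:
  assumes "B \<noteq> {}"
  shows "(SUP a\<in>A. INF b\<in>B. ennreal (mdist X a b)) < \<infinity> \<longleftrightarrow>
         (\<exists>r. \<forall>a\<in>A. \<exists>b\<in>B. mdist X a b \<le> r)"
proof
  assume "(SUP a\<in>A. INF b\<in>B. ennreal (mdist X a b)) < \<infinity>"
  then obtain s where s: "(SUP a\<in>A. INF b\<in>B. ennreal (mdist X a b)) = ennreal s" "0 \<le> s"
    unfolding infinity_ennreal_def less_top_ennreal by auto
  have "\<exists>b\<in>B. mdist X a b \<le> s + 1" if "a \<in> A" for a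
  proof -
    have "(INF b\<in>B. ennreal (mdist X a b)) \<le> ennreal s"
      unfolding s(1)[symmetric] by (rule SUP_upper[OF that])
    also have "ennreal s < ennreal (s + 1)" using s(2) by (simp add: ennreal_less_iff)
    finally obtain b where "b \<in> B" "ennreal (mdist X a b) < ennreal (s + 1)"
      by (auto simp: INF_less_iff)
    then have "b \<in> B" "mdist X a b \<le> s + 1"
      by (simp_all add: ennreal_less_iff Metric_space.nonneg[OF Metric_space_mspace_mdist])
    then show ?thesis by blast
  qed
  then show "\<exists>r. \<forall>a\<in>A. \<exists>b\<in>B. mdist X a b \<le> r" by blast
next
  assume "\<exists>r. \<forall>a\<in>A. \<exists>b\<in>B. mdist X a b \<le> r"
  then obtain r where r: "\<forall>a\<in>A. \<exists>b\<in>B. mdist X a b \<le> r" ..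
  have "(SUP a\<in>A. INF b\<in>B. ennreal (mdist X a b)) \<le> ennreal r"
  proof (rule SUP_least)
    fix a assume "a \<in> A"
    then obtain b where "b \<in> B" "mdist X a b \<le> r" using r by blast
    then show "(INF b\<in>B. ennreal (mdist X a b)) \<le> ennreal r"
      by (intro INF_lower2[of b]) (simp_all add: ennreal_leI)
  qed
  then show "(SUP a\<in>A. INF b\<in>B. ennreal (mdist X a b)) < \<infinity>"
    by (rule le_less_trans) simp
qed

lemma hausdorff_distance_finite_iff:
  assumes "A \<noteq> {}" "B \<noteq> {}"
  shows "hausdorff_distance X A B < \<infinity> \<longleftrightarrow>
         (\<exists>r. (\<forall>a\<in>A. \<exists>b\<in>B. mdist X a b \<le> r) \<and> (\<forall>b\<in>B. \<exists>a\<in>A. mdist X b a \<le> r))"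
    (is "_ \<longleftrightarrow> ?rhs")
proof -
  interpret Metric_space "mspace X" "mdist X" by (rule Metric_space_mspace_mdist)
  have "hausdorff_distance X A B < \<infinity> \<longleftrightarrow>
      (\<exists>r. \<forall>a\<in>A. \<exists>b\<in>B. mdist X a b \<le> r) \<and> (\<exists>r. \<forall>b\<in>B. \<exists>a\<in>A. mdist X b a \<le> r)"
    using one_sided_hausdorff_finite[OF assms(2), of X A]
      one_sided_hausdorff_finite[OF assms(1), of X B]
    by (simp add: hausdorff_distance_def commute)
  also have "\<dots> \<longleftrightarrow> ?rhs"
  proof
    assume "(\<exists>r. \<forall>a\<in>A. \<exists>b\<in>B. mdist X a b \<le> r) \<and> (\<exists>r. \<forall>b\<in>B. \<exists>a\<in>A. mdist X b a \<le> r)"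
    then obtain r s where "\<forall>a\<in>A. \<exists>b\<in>B. mdist X a b \<le> r" "\<forall>b\<in>B. \<exists>a\<in>A. mdist X b a \<le> s"
      by blast
    then show ?rhs by (intro exI[of _ "max r s"]) (meson max.coboundedI1 max.coboundedI2)
  qed blast
  finally show ?thesis .
qed

lemma coarse_map_range: "coarse_map nat_metric X \<phi> \<Longrightarrow> range \<phi> \<subseteq> mspace X"
  by (simp add: coarse_map_def)

lemma endpoint_rel_iff:
  "(\<phi>, \<psi>) \<in> endpoint_rel X \<longleftrightarrow>
     coarse_map nat_metric X \<phi> \<and> coarse_map nat_metric X \<psi> \<and>
     (\<exists>r. (\<forall>m. \<exists>n. mdist X (\<phi> m) (\<psi> n) \<le> r) \<and> (\<forall>n. \<exists>m. mdist X (\<psi> n) (\<phi> m) \<le> r))"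
  using hausdorff_distance_finite_iff[of "range \<phi>" "range \<psi>" X]
  by (simp add: endpoint_rel_def)

lemma equiv_endpoint_rel: "equiv {\<phi>. coarse_map nat_metric X \<phi>} (endpoint_rel X)"
proof (rule equivI)
  interpret Metric_space "mspace X" "mdist X" by (rule Metric_space_mspace_mdist)
  show "endpoint_rel X \<subseteq> {\<phi>. coarse_map nat_metric X \<phi>} \<times> {\<phi>. coarse_map nat_metric X \<phi>}"
    by (auto simp: endpoint_rel_def)
  show "refl_on {\<phi>. coarse_map nat_metric X \<phi>} (endpoint_rel X)"
  proof (rule refl_onI)
    fix \<phi> assume "\<phi> \<in> {\<phi>. coarse_map nat_metric X \<phi>}"
    then have c: "coarse_map nat_metric X \<phi>" by simp
    then have "mdist X (\<phi> m) (\<phi> m) \<le> 0" for m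
      using coarse_map_range[OF c] by (simp add: image_subset_iff)
    with c show "(\<phi>, \<phi>) \<in> endpoint_rel X" unfolding endpoint_rel_iff by blast
  qed
  show "sym (endpoint_rel X)"
    by (rule symI) (auto simp: endpoint_rel_iff)
  show "trans (endpoint_rel X)"
  proof (rule transI)
    fix \<phi> \<psi> \<omega> assume 1: "(\<phi>, \<psi>) \<in> endpoint_rel X" and 2: "(\<psi>, \<omega>) \<in> endpoint_rel X"
    then obtain r s where
      r: "\<forall>m. \<exists>n. mdist X (\<phi> m) (\<psi> n) \<le> r" "\<forall>n. \<exists>m. mdist X (\<psi> n) (\<phi> m) \<le> r" and
      s: "\<forall>m. \<exists>n. mdist X (\<psi> m) (\<omega> n) \<le> s" "\<forall>n. \<exists>m. mdist X (\<omega> n) (\<psi> m) \<le> s"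
      unfolding endpoint_rel_iff by (elim conjE exE) rule
    have c: "coarse_map nat_metric X \<phi>" "coarse_map nat_metric X \<psi>" "coarse_map nat_metric X \<omega>"
      using 1 2 by (auto simp: endpoint_rel_iff)
    have mem: "\<phi> n \<in> mspace X" "\<psi> n \<in> mspace X" "\<omega> n \<in> mspace X" for n
      using c[THEN coarse_map_range] by auto
    have "\<exists>k. mdist X (\<phi> m) (\<omega> k) \<le> r + s" for m
    proof -
      obtain n k where "mdist X (\<phi> m) (\<psi> n) \<le> r" "mdist X (\<psi> n) (\<omega> k) \<le> s"
        using r s by blast
      then have "mdist X (\<phi> m) (\<omega> k) \<le> r + s"
        using triangle[of "\<phi> m" "\<psi> n" "\<omega> k"] mem by force
      then show ?thesis ..
    qed
    moreover have "\<exists>m. mdist X (\<omega> k) (\<phi> m) \<le> r + s" for k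
    proof -
      obtain n m where "mdist X (\<omega> k) (\<psi> n) \<le> s" "mdist X (\<psi> n) (\<phi> m) \<le> r"
        using r s by blast
      then have "mdist X (\<omega> k) (\<phi> m) \<le> r + s"
        using triangle[of "\<omega> k" "\<psi> n" "\<phi> m"] mem by force
      then show ?thesis ..
    qed
    ultimately show "(\<phi>, \<omega>) \<in> endpoint_rel X"
      unfolding endpoint_rel_iff using c by blast
  qed
qed

lemma endpoint_classI:
  "coarse_map nat_metric X \<phi> \<Longrightarrow> endpoint_rel X `` {\<phi>} \<in> endpoints X"
  by (simp add: endpoints_def quotientI)


subsection \<open>Independence of representatives\<close>

lemma close_sets_nearby:
  assumes "close_sets X S U" "S' \<subseteq> mspace X" "\<And>s. s \<in> S \<Longrightarrow> \<exists>s'\<in>S'. mdist X s s' \<le> r"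
  shows "close_sets X S' U"
proof (rule ccontr)
  interpret Metric_space "mspace X" "mdist X" by (rule Metric_space_mspace_mdist)
  assume "\<not> close_sets X S' U"
  then have co: "coentourage X (S' \<times> U)" and M: "S \<subseteq> mspace X" "U \<subseteq> mspace X"
    using assms(1,2) by (auto simp: close_sets_def)
  have "coentourage X (S \<times> U)"
    unfolding coentourage_iff
  proof (intro conjI allI impI)
    show "S \<times> U \<subseteq> mspace X \<times> mspace X" using M by auto
    fix E assume E: "entourage X E"
    then obtain R where R: "\<And>x y. (x, y) \<in> E \<Longrightarrow> mdist X x y \<le> R"
      by (auto simp: entourage_iff)
    define E' where "E' = {(s', u) \<in> S' \<times> U. mdist X s' u \<le> r + R}"
    have "entourage X E'" using M assms(2) by (auto simp: entourage_iff E'_def)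
    then obtain B where B: "coarse_bounded X B" "E' \<inter> S' \<times> U \<subseteq> B \<times> B"
      using co unfolding coentourage_iff by blast
    have near: "\<exists>s'\<in>B. mdist X s s' \<le> r \<and> u \<in> B" if su: "(s, u) \<in> E \<inter> S \<times> U" for s u
    proof -
      obtain s' where s': "s' \<in> S'" "mdist X s s' \<le> r" using su assms(3) by auto
      have "mdist X s' u \<le> mdist X s' s + mdist X s u"
        using su s' M assms(2) by (intro triangle) auto
      then have "mdist X s' u \<le> r + R" using s'(2) R[of s u] su commute[of s s'] by force
      then have "(s', u) \<in> E' \<inter> S' \<times> U" using s' su by (auto simp: E'_def)
      then show ?thesis using B(2) s'(2) by auto
    qed
    have "coarse_bounded X (fst ` (E \<inter> S \<times> U))"
    proof (rule coarse_bounded_nearby[OF B(1)])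
      show "fst ` (E \<inter> S \<times> U) \<subseteq> mspace X" using M by auto
      show "\<exists>b\<in>B. mdist X a b \<le> r" if "a \<in> fst ` (E \<inter> S \<times> U)" for a
        using that near by fastforce
    qed
    with B(1) have "coarse_bounded X (B \<union> fst ` (E \<inter> S \<times> U))"
      by (simp add: coarse_bounded_Un)
    moreover have "E \<inter> S \<times> U \<subseteq> (B \<union> fst ` (E \<inter> S \<times> U)) \<times> (B \<union> fst ` (E \<inter> S \<times> U))"
      using near by force
    ultimately show "\<exists>B. coarse_bounded X B \<and> E \<inter> S \<times> U \<subseteq> B \<times> B" by blast
  qed
  then show False using assms(1) by (simp add: close_sets_def)
qed

lemma coarse_star_cong:
  assumes "(\<phi>, \<phi>') \<in> endpoint_rel X"
  shows "coarse_star X (range \<phi>) \<U> = coarse_star X (range \<phi>') \<U>"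
proof -
  obtain r where
    r: "\<forall>m. \<exists>n. mdist X (\<phi> m) (\<phi>' n) \<le> r" "\<forall>n. \<exists>m. mdist X (\<phi>' n) (\<phi> m) \<le> r"
    using assms unfolding endpoint_rel_iff by blast
  have c: "range \<phi> \<subseteq> mspace X" "range \<phi>' \<subseteq> mspace X"
    using assms by (simp_all add: endpoint_rel_def coarse_map_range)
  have "close_sets X (range \<phi>) U \<longleftrightarrow> close_sets X (range \<phi>') U" for U
  proof
    show "close_sets X (range \<phi>') U" if "close_sets X (range \<phi>) U"
      by (rule close_sets_nearby[OF that c(2), of r]) (use r(1) in auto)
    show "close_sets X (range \<phi>) U" if "close_sets X (range \<phi>') U"
      by (rule close_sets_nearby[OF that c(1), of r]) (use r(2) in auto)
  qed
  then show ?thesis by (simp add: coarse_star_def)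
qed

lemma cover_close_cong:
  assumes "(\<phi>, \<phi>') \<in> endpoint_rel X" "(\<psi>, \<psi>') \<in> endpoint_rel X" "\<forall>U\<in>\<U>. U \<subseteq> mspace X"
    "cover_close X \<U> \<phi> \<psi>"
  shows "cover_close X \<U> \<phi>' \<psi>'"
proof -
  interpret Metric_space "mspace X" "mdist X" by (rule Metric_space_mspace_mdist)
  obtain E where E: "entourage X E"
      "range \<psi> \<subseteq> thickening X E (coarse_star X (range \<phi>') \<U>)"
      "range \<phi> \<subseteq> thickening X E (coarse_star X (range \<psi>') \<U>)"
    using assms(4)
    by (auto simp: cover_close_def coarse_star_cong[OF assms(1)] coarse_star_cong[OF assms(2)])
  obtain R where R: "\<And>x y. (x, y) \<in> E \<Longrightarrow> mdist X x y \<le> R"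
    using E(1) by (auto simp: entourage_iff)
  have EM: "E \<subseteq> mspace X \<times> mspace X" using E(1) by (simp add: entourage_def)
  obtain r where r: "\<forall>n. \<exists>m. mdist X (\<phi>' n) (\<phi> m) \<le> r"
    using assms(1) unfolding endpoint_rel_iff by blast
  obtain s where s: "\<forall>n. \<exists>m. mdist X (\<psi>' n) (\<psi> m) \<le> s"
    using assms(2) unfolding endpoint_rel_iff by blast
  have mem: "range \<phi>' \<subseteq> mspace X" "range \<psi>' \<subseteq> mspace X"
    using assms(1,2) by (simp_all add: endpoint_rel_def coarse_map_range)
  define E' where "E' = {(x, y) \<in> mspace X \<times> mspace X. mdist X x y \<le> max r s + R}"
  have move: "range \<alpha>' \<subseteq> thickening X E' T"
    if T: "range \<alpha> \<subseteq> thickening X E T" and \<alpha>: "range \<alpha>' \<subseteq> mspace X"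
      and t: "\<And>n. \<exists>m. mdist X (\<alpha>' n) (\<alpha> m) \<le> t" "t \<le> max r s"
    for \<alpha> \<alpha>' :: "nat \<Rightarrow> 'a" and T t
  proof -
    have "\<alpha>' n \<in> thickening X E' T" for n
    proof -
      obtain m where m: "mdist X (\<alpha>' n) (\<alpha> m) \<le> t" using t by blast
      obtain a where a: "a \<in> T" "(\<alpha> m, a) \<in> E" using T by (auto simp: thickening_def)
      have in_M: "\<alpha>' n \<in> mspace X" "\<alpha> m \<in> mspace X" "a \<in> mspace X" using \<alpha> a EM by auto
      have "mdist X (\<alpha>' n) a \<le> mdist X (\<alpha>' n) (\<alpha> m) + mdist X (\<alpha> m) a"
        using in_M by (rule triangle)
      then have "mdist X (\<alpha>' n) a \<le> max r s + R" using m t(2) R[OF a(2)] by linarith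
      then show ?thesis using a(1) in_M by (auto simp: thickening_def E'_def)
    qed
    then show ?thesis by blast
  qed
  have "entourage X E'" by (auto simp: entourage_iff E'_def)
  moreover have "range \<psi>' \<subseteq> thickening X E' (coarse_star X (range \<phi>') \<U>)"
    by (rule move[OF E(2) mem(2) s[rule_format]]) simp
  moreover have "range \<phi>' \<subseteq> thickening X E' (coarse_star X (range \<psi>') \<U>)"
    by (rule move[OF E(3) mem(1) r[rule_format]]) simp
  ultimately show ?thesis unfolding cover_close_def by blast
qed

lemma cover_relation_class:
  assumes "coarse_cover X \<U>" "coarse_map nat_metric X \<phi>" "coarse_map nat_metric X \<psi>"
  shows "(endpoint_rel X `` {\<phi>}, endpoint_rel X `` {\<psi>}) \<in> cover_relation X \<U> \<longleftrightarrow>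
         cover_close X \<U> \<phi> \<psi>"
proof
  assume "(endpoint_rel X `` {\<phi>}, endpoint_rel X `` {\<psi>}) \<in> cover_relation X \<U>"
  then obtain \<phi>' \<psi>' where "(\<phi>, \<phi>') \<in> endpoint_rel X" "(\<psi>, \<psi>') \<in> endpoint_rel X"
    "cover_close X \<U> \<phi>' \<psi>'"
    by (auto simp: cover_relation_def)
  then show "cover_close X \<U> \<phi> \<psi>"
    using assms(1) equiv_endpoint_rel[of X]
    by (intro cover_close_cong[of \<phi>' \<phi> X \<psi>' \<psi>]) (auto simp: coarse_cover_def equiv_def dest: symD)
next
  assume "cover_close X \<U> \<phi> \<psi>"
  moreover have "\<phi> \<in> endpoint_rel X `` {\<phi>}" "\<psi> \<in> endpoint_rel X `` {\<psi>}"
    using equiv_class_self[OF equiv_endpoint_rel] assms by blast+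
  ultimately show "(endpoint_rel X `` {\<phi>}, endpoint_rel X `` {\<psi>}) \<in> cover_relation X \<U>"
    using assms endpoint_classI by (auto simp: cover_relation_def)
qed


subsection \<open>The induced map\<close>

lemma entourage_submetric:
  "entourage (submetric Y Z) E \<longleftrightarrow> entourage Y E \<and> E \<subseteq> Z \<times> Z"
  by (auto simp: entourage_def)

lemma coarse_bounded_submetric:
  "coarse_bounded (submetric Y Z) B \<longleftrightarrow> coarse_bounded Y B \<and> B \<subseteq> Z"
  by (auto simp: coarse_bounded_def entourage_submetric)

lemma coarse_map_inclusion: "coarse_map (submetric Y Z) Y id"
  by (auto simp: coarse_map_def entourage_submetric coarse_bounded_submetric map_prod.id
      intro: coarse_bounded_subset)

lemma coarse_map_comp:
  assumes "coarse_map X Y f" "coarse_map Y W g"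
  shows "coarse_map X W (g \<circ> f)"
  unfolding coarse_map_def
proof (intro conjI allI impI)
  show "(g \<circ> f) ` mspace X \<subseteq> mspace W"
    using assms by (auto simp: coarse_map_def image_subset_iff)
  show "entourage W (map_prod (g \<circ> f) (g \<circ> f) ` E)" if "entourage X E" for E
  proof -
    have "entourage W (map_prod g g ` map_prod f f ` E)"
      using assms that by (simp add: coarse_map_def)
    then show ?thesis by (simp add: image_comp map_prod.comp)
  qed
  show "coarse_bounded X ((g \<circ> f) -` B \<inter> mspace X)" if B: "coarse_bounded W B" for B
  proof -
    have "coarse_bounded X (f -` (g -` B \<inter> mspace Y) \<inter> mspace X)"
      using assms B unfolding coarse_map_def by blast
    then show ?thesis
      by (rule coarse_bounded_subset) (use assms in \<open>auto simp: coarse_map_def\<close>)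
  qed
qed

lemma endpoint_rel_comp:
  assumes f: "coarse_map X Y f" and rel: "(\<phi>, \<psi>) \<in> endpoint_rel X"
  shows "(f \<circ> \<phi>, f \<circ> \<psi>) \<in> endpoint_rel Y"
proof -
  interpret Metric_space "mspace X" "mdist X" by (rule Metric_space_mspace_mdist)
  obtain r where r: "\<forall>m. \<exists>n. mdist X (\<phi> m) (\<psi> n) \<le> r" "\<forall>n. \<exists>m. mdist X (\<psi> n) (\<phi> m) \<le> r"
    and c: "coarse_map nat_metric X \<phi>" "coarse_map nat_metric X \<psi>"
    using rel unfolding endpoint_rel_iff by blast
  have mem: "\<phi> n \<in> mspace X" "\<psi> n \<in> mspace X" for n using c[THEN coarse_map_range] by auto
  define E where "E = {(x, y) \<in> mspace X \<times> mspace X. mdist X x y \<le> r}"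
  have "entourage X E" by (auto simp: entourage_iff E_def)
  then have "entourage Y (map_prod f f ` E)" using f by (simp add: coarse_map_def)
  then obtain s where s: "\<And>x y. (x, y) \<in> map_prod f f ` E \<Longrightarrow> mdist Y x y \<le> s"
    by (auto simp: entourage_iff)
  have s': "mdist Y (f x) (f y) \<le> s"
    if "mdist X x y \<le> r" "x \<in> mspace X" "y \<in> mspace X" for x y
    using that by (intro s) (force simp: E_def)
  have "\<exists>n. mdist Y ((f \<circ> \<phi>) m) ((f \<circ> \<psi>) n) \<le> s" for m
    using r(1)[rule_format, of m] s' mem by fastforce
  moreover have "\<exists>m. mdist Y ((f \<circ> \<psi>) n) ((f \<circ> \<phi>) m) \<le> s" for n
    using r(2)[rule_format, of n] s' mem by fastforce
  ultimately show ?thesis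
    using coarse_map_comp[OF c(1) f] coarse_map_comp[OF c(2) f] unfolding endpoint_rel_iff by blast
qed

lemma endpoint_map_class:
  assumes "coarse_map X Y f" "coarse_map nat_metric X \<phi>"
  shows "endpoint_map Y f (endpoint_rel X `` {\<phi>}) = endpoint_rel Y `` {f \<circ> \<phi>}"
proof -
  have "endpoint_rel Y `` {f \<circ> \<psi>} = endpoint_rel Y `` {f \<circ> \<phi>}"
    if "\<psi> \<in> endpoint_rel X `` {\<phi>}" for \<psi>
    using that endpoint_rel_comp[OF assms(1)] equiv_class_eq[OF equiv_endpoint_rel] by blast
  moreover have "\<phi> \<in> endpoint_rel X `` {\<phi>}"
    using equiv_class_self[OF equiv_endpoint_rel] assms(2) by blast
  ultimately show ?thesis unfolding endpoint_map_def by blast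
qed

end

theory Submission
  imports Defs
begin

text \<open>
  Coarse maps into \<open>Z\<close>, and the equivalence of two of them, are the same whether they are
  measured in \<open>Z\<close> or in \<open>Y\<close>; hence the induced map on endpoints is well defined and injective.
  What remains is to compare coarse covers of \<open>Z\<close> with coarse covers of \<open>Y\<close>.

  A coarse cover of \<open>Y\<close> restricts to \<open>Z\<close> by intersecting its members with \<open>Z\<close>, and endpoints
  that are near for the restriction are near for the original cover. This is uniform
  continuity of the induced map.

  For the inverse, a coarse cover \<open>\<V>\<close> of \<open>Z\<close> has to be extended to \<open>Y\<close>. Choose an
  almost nearest point map \<open>\<pi>\<close> from \<open>Y\<close> to \<open>Z\<close> and pull the members of \<open>\<V>\<close> back along it.
  A subset of \<open>Z\<close> meets points of \<open>\<pi> -` V\<close> within distance \<open>r\<close> only where \<open>\<pi>\<close> moves them by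
  at most \<open>r + 1\<close>, so a subset of \<open>Z\<close> that is close to \<open>\<pi> -` V\<close> is already close to \<open>V\<close>
  (\<open>close_pullbackD\<close>). The pullbacks do not form a coarse cover, because \<open>\<pi>\<close> can tear apart nearby points
  that are far away from \<open>Z\<close>. The points where this happens at a scale below their
  distance to \<open>Z\<close> are collected in one additional member. Near \<open>Z\<close> such points involve pairs of
  \<open>Z\<close> at bounded distance that share no member of \<open>\<V>\<close>, and these are confined to a bounded set.
  So the additional member is not close to any subset of \<open>Z\<close> (\<open>not_close_torn\<close>), never enters
  the coarse star of such a set, and thus does not influence nearness of endpoints of \<open>Z\<close>. Far
  from \<open>Z\<close> it absorbs the pairs that the pullbacks miss, so that together they are a coarse cover
  of \<open>Y\<close> (\<open>coarse_cover_extended\<close>).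
\<close>

section \<open>Coentourages and closeness in a subspace\<close>

text \<open>For pairs at bounded distance, boundedness of one coordinate forces that of the other.\<close>

lemma coentourage_iff_bounded_fst:
  assumes C: "C \<subseteq> mspace X \<times> mspace X"
  shows "coentourage X C \<longleftrightarrow> (\<forall>r. coarse_bounded X {x. \<exists>y. (x, y) \<in> C \<and> mdist X x y \<le> r})"
proof (intro iffI allI)
  fix r assume co: "coentourage X C"
  have "entourage X {(x, y) \<in> C. mdist X x y \<le> r}"
    using C by (auto simp: entourage_iff)
  then obtain B where "coarse_bounded X B" "{(x, y) \<in> C. mdist X x y \<le> r} \<inter> C \<subseteq> B \<times> B"
    using co unfolding coentourage_iff by blast
  then show "coarse_bounded X {x. \<exists>y. (x, y) \<in> C \<and> mdist X x y \<le> r}"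
    by (elim coarse_bounded_subset) auto
next
  assume bd: "\<forall>r. coarse_bounded X {x. \<exists>y. (x, y) \<in> C \<and> mdist X x y \<le> r}"
  interpret Metric_space "mspace X" "mdist X" by (rule Metric_space_mspace_mdist)
  show "coentourage X C"
    unfolding coentourage_iff
  proof (intro conjI allI impI C)
    fix E assume "entourage X E"
    then obtain r where r: "\<And>x y. (x, y) \<in> E \<Longrightarrow> mdist X x y \<le> r"
      by (auto simp: entourage_iff)
    define P where "P = {x. \<exists>y. (x, y) \<in> C \<and> mdist X x y \<le> r}"
    define Q where "Q = {y. \<exists>x. (x, y) \<in> C \<and> mdist X x y \<le> r}"
    have P: "coarse_bounded X P" using bd by (simp add: P_def)
    have "coarse_bounded X Q"
    proof (rule coarse_bounded_nearby[OF P, where r = r])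
      show "Q \<subseteq> mspace X" using C by (auto simp: Q_def)
      show "\<exists>x\<in>P. mdist X y x \<le> r" if "y \<in> Q" for y
        using that commute by (fastforce simp: P_def Q_def)
    qed
    with P have "coarse_bounded X (P \<union> Q)" by (simp add: coarse_bounded_Un)
    moreover have "E \<inter> C \<subseteq> (P \<union> Q) \<times> (P \<union> Q)" using r by (auto simp: P_def Q_def)
    ultimately show "\<exists>B. coarse_bounded X B \<and> E \<inter> C \<subseteq> B \<times> B" by blast
  qed
qed

lemma coentourage_mono: "coentourage X C \<Longrightarrow> C' \<subseteq> C \<Longrightarrow> coentourage X C'"
  unfolding coentourage_iff by (meson Int_mono order_refl order_trans)

lemma close_sets_mono:
  "close_sets X A B \<Longrightarrow> A \<subseteq> A' \<Longrightarrow> B \<subseteq> B' \<Longrightarrow> A' \<subseteq> mspace X \<Longrightarrow> B' \<subseteq> mspace X \<Longrightarrow> close_sets X A' B'"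
  unfolding close_sets_def by (meson Sigma_mono coentourage_mono)

lemma coentourage_submetric:
  assumes "Z \<subseteq> mspace Y" "C \<subseteq> Z \<times> Z"
  shows "coentourage (submetric Y Z) C \<longleftrightarrow> coentourage Y C"
proof -
  have "range x \<subseteq> Z \<and> range y \<subseteq> Z" if "\<forall>i. (x i, y i) \<in> C" for x y :: "nat \<Rightarrow> 'a"
    using that assms(2) by blast
  moreover have "C \<subseteq> mspace Y \<times> mspace Y" using assms by blast
  ultimately show ?thesis
    using assms unfolding coentourage_def coarse_bounded_submetric by (auto 0 3)
qed

lemma close_sets_submetric:
  assumes "Z \<subseteq> mspace Y" "A \<subseteq> Z" "B \<subseteq> Z"
  shows "close_sets (submetric Y Z) A B \<longleftrightarrow> close_sets Y A B"
proof -
  have "A \<times> B \<subseteq> Z \<times> Z" using assms by blast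
  then show ?thesis using assms by (auto simp: close_sets_def coentourage_submetric)
qed

section \<open>Restricting coarse covers\<close>

lemma coarse_cover_restrict:
  assumes Z: "Z \<subseteq> mspace Y" and \<U>: "coarse_cover Y \<U>"
  shows "coarse_cover (submetric Y Z) ((\<lambda>U. U \<inter> Z) ` \<U>)"
proof -
  have "coentourage Y (Z \<times> Z - (\<Union>V\<in>(\<lambda>U. U \<inter> Z) ` \<U>. V \<times> V))"
    by (rule coentourage_mono[of _ "mspace Y \<times> mspace Y - (\<Union>U\<in>\<U>. U \<times> U)"])
      (use Z \<U> in \<open>auto simp: coarse_cover_def\<close>)
  moreover have "Z \<inter> mspace Y = Z" using Z by blast
  ultimately show ?thesis
    using \<U> Z by (simp add: coarse_cover_def coentourage_submetric)
qed

lemma cover_close_restrict: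
  assumes Z: "Z \<subseteq> mspace Y" and \<U>: "\<forall>U\<in>\<U>. U \<subseteq> mspace Y"
    and \<phi>: "range \<phi> \<subseteq> Z" and \<psi>: "range \<psi> \<subseteq> Z"
    and close: "cover_close (submetric Y Z) ((\<lambda>U. U \<inter> Z) ` \<U>) \<phi> \<psi>"
  shows "cover_close Y \<U> \<phi> \<psi>"
proof -
  let ?\<V> = "(\<lambda>U. U \<inter> Z) ` \<U>"
  have star: "coarse_star (submetric Y Z) S ?\<V> \<subseteq> coarse_star Y S \<U>" if S: "S \<subseteq> Z" for S
  proof -
    have "close_sets Y S U" if "U \<in> \<U>" "close_sets (submetric Y Z) S (U \<inter> Z)" for U
    proof (rule close_sets_mono)
      show "close_sets Y S (U \<inter> Z)" using that Z S by (simp add: close_sets_submetric)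
    qed (use that Z S \<U> in auto)
    then show ?thesis unfolding coarse_star_def by blast
  qed
  obtain E where E: "entourage (submetric Y Z) E"
    "range \<psi> \<subseteq> thickening (submetric Y Z) E (coarse_star (submetric Y Z) (range \<phi>) ?\<V>)"
    "range \<phi> \<subseteq> thickening (submetric Y Z) E (coarse_star (submetric Y Z) (range \<psi>) ?\<V>)"
    using close unfolding cover_close_def by blast
  have "entourage Y E" using E(1) by (simp add: entourage_submetric)
  moreover have "range \<psi> \<subseteq> thickening Y E (coarse_star Y (range \<phi>) \<U>)"
    "range \<phi> \<subseteq> thickening Y E (coarse_star Y (range \<psi>) \<U>)"
    using E(2,3) star[OF \<phi>] star[OF \<psi>] Z unfolding thickening_def by fastforce+
  ultimately show ?thesis unfolding cover_close_def by blast
qed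

section \<open>Extending coarse covers\<close>

text \<open>The slack \<open>1\<close> makes such a map exist although distances to \<open>Z\<close> need not be attained.\<close>

locale almost_nearest_point_map =
  fixes Y :: "'a metric" and Z :: "'a set" and \<pi> :: "'a \<Rightarrow> 'a"
  assumes Z_subset: "Z \<subseteq> mspace Y"
    and proj_in: "\<And>y. y \<in> mspace Y \<Longrightarrow> \<pi> y \<in> Z"
    and proj_dist: "\<And>y z. y \<in> mspace Y \<Longrightarrow> z \<in> Z \<Longrightarrow> mdist Y y (\<pi> y) \<le> mdist Y y z + 1"

lemma almost_nearest_point_map_exists:
  assumes "Z \<subseteq> mspace Y" "Z \<noteq> {}"
  obtains \<pi> where "almost_nearest_point_map Y Z \<pi>"
proof -
  interpret Metric_space "mspace Y" "mdist Y" by (rule Metric_space_mspace_mdist)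
  have "\<exists>p\<in>Z. \<forall>z\<in>Z. mdist Y y p \<le> mdist Y y z + 1" for y
  proof -
    define m where "m = (INF z\<in>Z. mdist Y y z)"
    have "bdd_below (mdist Y y ` Z)" by (rule bdd_belowI[of _ 0]) auto
    then have m: "m \<le> mdist Y y z" if "z \<in> Z" for z
      unfolding m_def using that by (rule cINF_lower)
    have "m < m + 1" by simp
    then obtain p where "p \<in> Z" "mdist Y y p < m + 1"
      using cINF_less_iff[OF assms(2) \<open>bdd_below (mdist Y y ` Z)\<close>, of "m + 1"]
      by (auto simp: m_def[symmetric])
    with m show ?thesis by force
  qed
  then obtain \<pi> where "\<And>y. \<pi> y \<in> Z" "\<And>y z. z \<in> Z \<Longrightarrow> mdist Y y (\<pi> y) \<le> mdist Y y z + 1"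
    by metis
  with assms(1) show thesis by (intro that[of \<pi>]) unfold_locales
qed

context almost_nearest_point_map
begin

sublocale Metric_space "mspace Y" "mdist Y" by (rule Metric_space_mspace_mdist)

definition pullback :: "'a set \<Rightarrow> 'a set" where
  "pullback V = {y \<in> mspace Y. \<pi> y \<in> V}"

text \<open>The points that \<open>\<pi>\<close> separates, with respect to \<open>\<V>\<close>, from a point no farther away than
  \<open>Z\<close>. Comparing with \<open>mdist Y y (\<pi> y)\<close> makes the scale grow with the distance from
  \<open>Z\<close>: at a fixed distance from \<open>Z\<close> the scale is bounded, which keeps this set away from \<open>Z\<close>,
  and far from \<open>Z\<close> every fixed scale is eventually admitted, which is what a coarse cover needs.\<close>

definition torn :: "'a set set \<Rightarrow> 'a set" where
  "torn \<V> = {y \<in> mspace Y. \<exists>x\<in>mspace Y. (\<pi> x, \<pi> y) \<notin> (\<Union>V\<in>\<V>. V \<times> V) \<and>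
                                    mdist Y x y \<le> mdist Y y (\<pi> y)}"

definition separated_near :: "'a set set \<Rightarrow> real \<Rightarrow> 'a set" where
  "separated_near \<V> r = {y \<in> mspace Y. \<exists>x\<in>mspace Y. (\<pi> x, \<pi> y) \<notin> (\<Union>V\<in>\<V>. V \<times> V) \<and>
                                   mdist Y x y \<le> r \<and> mdist Y y (\<pi> y) \<le> r}"

definition extended_cover :: "'a set set \<Rightarrow> 'a set set" where
  "extended_cover \<V> = insert (torn \<V>) (pullback ` \<V>)"

lemma proj_in_mspace: "y \<in> mspace Y \<Longrightarrow> \<pi> y \<in> mspace Y"
  by (rule subsetD[OF Z_subset proj_in])

lemma proj_dist_le:
  assumes "x \<in> mspace Y" "y \<in> mspace Y"
  shows "mdist Y x (\<pi> x) \<le> mdist Y x y + mdist Y y (\<pi> y) + 1"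
  using proj_dist[OF assms(1) proj_in[OF assms(2)]]
    triangle[OF assms proj_in_mspace[OF assms(2)]] by linarith

lemma dist_proj_proj_le:
  assumes "x \<in> mspace Y" "y \<in> mspace Y"
  shows "mdist Y (\<pi> x) (\<pi> y) \<le> 2 * mdist Y x y + 2 * mdist Y y (\<pi> y) + 1"
  using triangle[OF proj_in_mspace[OF assms(1)] assms(1) proj_in_mspace[OF assms(2)]]
    triangle[OF assms proj_in_mspace[OF assms(2)]] commute[of "\<pi> x" x] proj_dist_le[OF assms]
  by linarith

lemma dist_proj_le:
  assumes "z \<in> Z" "y \<in> mspace Y"
  shows "mdist Y z (\<pi> y) \<le> 2 * mdist Y z y + 1"
proof -
  have "z \<in> mspace Y" using assms(1) Z_subset by blast
  then show ?thesis
    using proj_dist[OF assms(2,1)] triangle[OF _ assms(2) proj_in_mspace[OF assms(2)], of z]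
      commute[of z y] by linarith
qed

text \<open>Within bounded distance of \<open>Z\<close> the projection distorts bounded distances only boundedly,
  so there a pair separated by \<open>\<pi>\<close> comes from a pair of \<open>Z\<close> that the coarse cover confines to
  a bounded set.\<close>

lemma bounded_separated_near_subspace:
  assumes cov: "coarse_cover (submetric Y Z) \<V>"
  shows "coarse_bounded Y (separated_near \<V> r)"
proof -
  let ?bad = "Z \<times> Z - (\<Union>V\<in>\<V>. V \<times> V)"
  have "mspace (submetric Y Z) = Z" using Z_subset by auto
  then have "coentourage Y ?bad"
    using cov Z_subset by (simp add: coarse_cover_def coentourage_submetric)
  moreover have "?bad \<subseteq> mspace Y \<times> mspace Y" using Z_subset by blast
  ultimately have bd: "coarse_bounded Y {a. \<exists>b. (a, b) \<in> ?bad \<and> mdist Y a b \<le> 4 * r + 1}"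
    (is "coarse_bounded Y ?B") by (simp add: coentourage_iff_bounded_fst)
  show ?thesis
  proof (rule coarse_bounded_nearby[OF bd])
    show "separated_near \<V> r \<subseteq> mspace Y" by (auto simp: separated_near_def)
    fix y assume "y \<in> separated_near \<V> r"
    then obtain x where y: "y \<in> mspace Y" "mdist Y y (\<pi> y) \<le> r"
      and x: "x \<in> mspace Y" "(\<pi> x, \<pi> y) \<notin> (\<Union>V\<in>\<V>. V \<times> V)" "mdist Y x y \<le> r"
      unfolding separated_near_def by blast
    have "mdist Y (\<pi> y) (\<pi> x) \<le> 4 * r + 1"
      using dist_proj_proj_le[OF x(1) y(1)] commute[of "\<pi> x" "\<pi> y"] x y by linarith
    then have "\<pi> y \<in> ?B" using x y proj_in[OF x(1)] proj_in[OF y(1)] by blast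
    then show "\<exists>b\<in>?B. mdist Y y b \<le> r" using y(2) by blast
  qed
qed

lemma not_close_torn:
  assumes cov: "coarse_cover (submetric Y Z) \<V>" and S: "S \<subseteq> Z"
  shows "\<not> close_sets Y S (torn \<V>)"
proof -
  have sub: "S \<times> torn \<V> \<subseteq> mspace Y \<times> mspace Y" using S Z_subset by (auto simp: torn_def)
  have "coarse_bounded Y {s. \<exists>u. (s, u) \<in> S \<times> torn \<V> \<and> mdist Y s u \<le> r}" for r
  proof (rule coarse_bounded_nearby[OF bounded_separated_near_subspace[OF cov, of "r + 1"]])
    show "{s. \<exists>u. (s, u) \<in> S \<times> torn \<V> \<and> mdist Y s u \<le> r} \<subseteq> mspace Y"
      using S Z_subset by blast
    fix s assume "s \<in> {s. \<exists>u. (s, u) \<in> S \<times> torn \<V> \<and> mdist Y s u \<le> r}"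
    then obtain u where su: "s \<in> Z" "u \<in> torn \<V>" "mdist Y s u \<le> r" using S by blast
    then obtain x where u: "u \<in> mspace Y"
      and x: "x \<in> mspace Y" "(\<pi> x, \<pi> u) \<notin> (\<Union>V\<in>\<V>. V \<times> V)" "mdist Y x u \<le> mdist Y u (\<pi> u)"
      unfolding torn_def by blast
    have "mdist Y u (\<pi> u) \<le> r + 1"
      using proj_dist[OF u su(1)] su(3) commute[of s u] by linarith
    moreover from this have "mdist Y x u \<le> r + 1" using x(3) by linarith
    ultimately have "u \<in> separated_near \<V> (r + 1)"
      using u x(1,2) unfolding separated_near_def by blast
    with su(3) show "\<exists>u\<in>separated_near \<V> (r + 1). mdist Y s u \<le> r" by blast
  qed
  then have "coentourage Y (S \<times> torn \<V>)" unfolding coentourage_iff_bounded_fst[OF sub] by (rule allI)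
  then show ?thesis by (simp add: close_sets_def)
qed

text \<open>A pair in no pullback is separated by \<open>\<pi>\<close>. If it is not contained in \<open>torn \<V>\<close>, one of its
  points is nearer to \<open>Z\<close> than to the other point, so at bounded distance both are
  near \<open>Z\<close>.\<close>

lemma coarse_cover_extended:
  assumes cov: "coarse_cover (submetric Y Z) \<V>"
  shows "coarse_cover Y (extended_cover \<V>)"
proof -
  let ?bad = "mspace Y \<times> mspace Y - (\<Union>U\<in>extended_cover \<V>. U \<times> U)"
  have "coarse_bounded Y {x. \<exists>y. (x, y) \<in> ?bad \<and> mdist Y x y \<le> r}" for r
  proof (rule coarse_bounded_subset[OF bounded_separated_near_subspace[OF cov, of "2 * r + 1"]], rule subsetI)
    fix x assume "x \<in> {x. \<exists>y. (x, y) \<in> ?bad \<and> mdist Y x y \<le> r}"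
    then obtain y where xy: "x \<in> mspace Y" "y \<in> mspace Y" "mdist Y x y \<le> r"
      and bad: "(x, y) \<notin> (\<Union>U\<in>extended_cover \<V>. U \<times> U)"
      by blast
    have sep: "(\<pi> y, \<pi> x) \<notin> (\<Union>V\<in>\<V>. V \<times> V)" "(\<pi> x, \<pi> y) \<notin> (\<Union>V\<in>\<V>. V \<times> V)"
      using bad xy by (auto simp: extended_cover_def pullback_def)
    have "x \<notin> torn \<V> \<or> y \<notin> torn \<V>" using bad by (auto simp: extended_cover_def)
    then have "mdist Y x (\<pi> x) < mdist Y x y \<or> mdist Y y (\<pi> y) < mdist Y x y"
    proof
      assume "x \<notin> torn \<V>"
      then have "\<not> mdist Y y x \<le> mdist Y x (\<pi> x)"
        using xy(1,2) sep(1) unfolding torn_def by blast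
      then show ?thesis using commute[of x y] by linarith
    next
      assume "y \<notin> torn \<V>"
      then have "\<not> mdist Y x y \<le> mdist Y y (\<pi> y)"
        using xy(1,2) sep(2) unfolding torn_def by blast
      then show ?thesis by linarith
    qed
    then have "mdist Y x (\<pi> x) \<le> 2 * r + 1"
      using proj_dist_le[OF xy(1,2)] xy(3) nonneg[of x y] by linarith
    moreover have "mdist Y y x \<le> 2 * r + 1" using xy(3) commute[of x y] nonneg[of x y] by linarith
    ultimately show "x \<in> separated_near \<V> (2 * r + 1)"
      using xy(1,2) sep(1) unfolding separated_near_def by blast
  qed
  then have "coentourage Y ?bad" by (subst coentourage_iff_bounded_fst) auto
  then show ?thesis
    using cov by (auto simp: coarse_cover_def extended_cover_def pullback_def torn_def)
qed

lemma close_pullbackD: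
  assumes "close_sets Y S (pullback V)" "S \<subseteq> Z" "V \<subseteq> Z"
  shows "close_sets Y S V"
proof (rule ccontr)
  have sub: "S \<times> V \<subseteq> mspace Y \<times> mspace Y" "S \<times> pullback V \<subseteq> mspace Y \<times> mspace Y"
    using assms Z_subset by (auto simp: pullback_def)
  assume "\<not> close_sets Y S V"
  then have "coentourage Y (S \<times> V)" using assms(2,3) Z_subset by (auto simp: close_sets_def)
  then have bd: "coarse_bounded Y {s. \<exists>v. (s, v) \<in> S \<times> V \<and> mdist Y s v \<le> r}" for r
    by (simp only: coentourage_iff_bounded_fst[OF sub(1)])
  have "coarse_bounded Y {s. \<exists>u. (s, u) \<in> S \<times> pullback V \<and> mdist Y s u \<le> r}" for r
  proof (rule coarse_bounded_subset[OF bd[of "2 * r + 1"]], clarify)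
    fix s u assume su: "s \<in> S" "u \<in> pullback V" "mdist Y s u \<le> r"
    then have "mdist Y s (\<pi> u) \<le> 2 * r + 1"
      using dist_proj_le[of s u] assms(2) by (force simp: pullback_def)
    then show "\<exists>v. (s, v) \<in> S \<times> V \<and> mdist Y s v \<le> 2 * r + 1"
      using su by (auto simp: pullback_def)
  qed
  then have "coentourage Y (S \<times> pullback V)" unfolding coentourage_iff_bounded_fst[OF sub(2)] by (rule allI)
  with assms(1) show False by (simp add: close_sets_def)
qed

text \<open>By \<open>not_close_torn\<close>, the star of \<open>S\<close> in the extended cover consists of pullbacks only, and
  a point of \<open>Z\<close> near some \<open>u\<close> in a pullback is near \<open>\<pi> u\<close>.\<close>

lemma star_extended_cover_near:
  assumes cov: "coarse_cover (submetric Y Z) \<V>" and S: "S \<subseteq> Z"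
    and z: "z \<in> Z" and u: "u \<in> coarse_star Y S (extended_cover \<V>)"
  shows "\<exists>v\<in>coarse_star (submetric Y Z) S \<V>. mdist Y z v \<le> 2 * mdist Y z u + 1"
proof -
  obtain U where U: "U \<in> extended_cover \<V>" "close_sets Y S U" "u \<in> U"
    using u unfolding coarse_star_def by blast
  then obtain V where V: "V \<in> \<V>" "U = pullback V"
    using not_close_torn[OF cov S] unfolding extended_cover_def by blast
  have "V \<subseteq> Z" using cov V(1) by (auto simp: coarse_cover_def)
  then have "close_sets (submetric Y Z) S V"
    using close_pullbackD U(2) V(2) S Z_subset by (simp add: close_sets_submetric)
  then have "\<pi> u \<in> coarse_star (submetric Y Z) S \<V>"
    using U(3) V unfolding coarse_star_def by (auto simp: pullback_def)
  then show ?thesis using dist_proj_le[OF z, of u] U(3) V(2) by (auto simp: pullback_def)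
qed

lemma cover_close_extendedD:
  assumes cov: "coarse_cover (submetric Y Z) \<V>"
    and \<phi>: "range \<phi> \<subseteq> Z" and \<psi>: "range \<psi> \<subseteq> Z"
    and close: "cover_close Y (extended_cover \<V>) \<phi> \<psi>"
  shows "cover_close (submetric Y Z) \<V> \<phi> \<psi>"
proof -
  obtain E where E: "entourage Y E"
    "range \<psi> \<subseteq> thickening Y E (coarse_star Y (range \<phi>) (extended_cover \<V>))"
    "range \<phi> \<subseteq> thickening Y E (coarse_star Y (range \<psi>) (extended_cover \<V>))"
    using close unfolding cover_close_def by blast
  obtain r where r: "\<And>x y. (x, y) \<in> E \<Longrightarrow> mdist Y x y \<le> r"
    using E(1) by (auto simp: entourage_iff)
  define F where "F = {(x, y) \<in> Z \<times> Z. mdist Y x y \<le> 2 * r + 1}"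
  have "entourage Y F" using Z_subset by (auto simp: entourage_iff F_def)
  then have F: "entourage (submetric Y Z) F" by (auto simp: entourage_submetric F_def)
  have star: "T \<subseteq> thickening (submetric Y Z) F (coarse_star (submetric Y Z) S \<V>)"
    if T: "T \<subseteq> thickening Y E (coarse_star Y S (extended_cover \<V>))"
      and ST: "S \<subseteq> Z" "T \<subseteq> Z" for S T
  proof
    fix t assume t: "t \<in> T"
    then obtain u where u: "u \<in> coarse_star Y S (extended_cover \<V>)" "(t, u) \<in> E"
      using T by (auto simp: thickening_def)
    obtain v where v: "v \<in> coarse_star (submetric Y Z) S \<V>" "mdist Y t v \<le> 2 * mdist Y t u + 1"
      using star_extended_cover_near[OF cov ST(1) _ u(1)] t ST by blast
    have "v \<in> Z" using v(1) cov by (auto simp: coarse_star_def coarse_cover_def)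
    then show "t \<in> thickening (submetric Y Z) F (coarse_star (submetric Y Z) S \<V>)"
      using v r[OF u(2)] t ST Z_subset by (force simp: thickening_def F_def)
  qed
  show ?thesis
    using F star[OF E(2) \<phi> \<psi>] star[OF E(3) \<psi> \<phi>] unfolding cover_close_def by blast
qed

end

section \<open>Endpoints of a subspace\<close>

lemma coarse_map_submetricD:
  assumes "coarse_map nat_metric (submetric Y Z) \<phi>"
  shows "coarse_map nat_metric Y \<phi>" "range \<phi> \<subseteq> Z"
  using coarse_map_comp[OF assms coarse_map_inclusion] coarse_map_range[OF assms] by auto

lemma endpoint_rel_submetric:
  assumes "coarse_map nat_metric (submetric Y Z) \<phi>" "coarse_map nat_metric (submetric Y Z) \<psi>"
  shows "(\<phi>, \<psi>) \<in> endpoint_rel (submetric Y Z) \<longleftrightarrow> (\<phi>, \<psi>) \<in> endpoint_rel Y"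
  using assms coarse_map_submetricD by (auto simp: endpoint_rel_iff)

lemma endpoint_map_inclusion_class:
  assumes "coarse_map nat_metric (submetric Y Z) \<phi>"
  shows "endpoint_map Y id (endpoint_rel (submetric Y Z) `` {\<phi>}) = endpoint_rel Y `` {\<phi>}"
  using endpoint_map_class[OF coarse_map_inclusion assms] by simp

lemma endpoints_cases:
  assumes "p \<in> endpoints X"
  obtains \<phi> where "coarse_map nat_metric X \<phi>" "p = endpoint_rel X `` {\<phi>}"
  using assms unfolding endpoints_def by (auto elim: quotientE)

lemma endpoint_map_inclusion_in:
  assumes "p \<in> endpoints (submetric Y Z)"
  shows "endpoint_map Y id p \<in> endpoints Y"
  using assms by (elim endpoints_cases)
    (simp add: endpoint_map_inclusion_class endpoint_classI coarse_map_submetricD)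

lemma inj_on_endpoint_map_inclusion:
  "inj_on (endpoint_map Y id) (endpoints (submetric Y Z))"
proof (rule inj_onI)
  fix p q assume pq: "p \<in> endpoints (submetric Y Z)" "q \<in> endpoints (submetric Y Z)"
    and eq: "endpoint_map Y id p = endpoint_map Y id q"
  obtain \<phi> where \<phi>: "coarse_map nat_metric (submetric Y Z) \<phi>"
      "p = endpoint_rel (submetric Y Z) `` {\<phi>}"
    using pq(1) by (rule endpoints_cases)
  obtain \<psi> where \<psi>: "coarse_map nat_metric (submetric Y Z) \<psi>"
      "q = endpoint_rel (submetric Y Z) `` {\<psi>}"
    using pq(2) by (rule endpoints_cases)
  have "endpoint_rel Y `` {\<phi>} = endpoint_rel Y `` {\<psi>}"
    using eq \<phi> \<psi> by (simp add: endpoint_map_inclusion_class)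
  then have "(\<phi>, \<psi>) \<in> endpoint_rel Y"
    using eq_equiv_class[OF _ equiv_endpoint_rel] coarse_map_submetricD(1)[OF \<psi>(1)] by blast
  then have "(\<phi>, \<psi>) \<in> endpoint_rel (submetric Y Z)"
    using \<phi> \<psi> by (simp add: endpoint_rel_submetric)
  then show "p = q"
    using equiv_class_eq[OF equiv_endpoint_rel] \<phi>(2) \<psi>(2) by blast
qed

lemma cover_relation_restrict:
  assumes Z: "Z \<subseteq> mspace Y" and \<U>: "coarse_cover Y \<U>"
    and pq: "(p, q) \<in> cover_relation (submetric Y Z) ((\<lambda>U. U \<inter> Z) ` \<U>)"
  shows "(endpoint_map Y id p, endpoint_map Y id q) \<in> cover_relation Y \<U>"
proof -
  have "p \<in> endpoints (submetric Y Z)" "q \<in> endpoints (submetric Y Z)"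
    using pq by (auto simp: cover_relation_def)
  then obtain \<phi> \<psi> where \<phi>: "coarse_map nat_metric (submetric Y Z) \<phi>"
      "p = endpoint_rel (submetric Y Z) `` {\<phi>}"
    and \<psi>: "coarse_map nat_metric (submetric Y Z) \<psi>"
      "q = endpoint_rel (submetric Y Z) `` {\<psi>}"
    by (metis endpoints_cases)
  have "cover_close (submetric Y Z) ((\<lambda>U. U \<inter> Z) ` \<U>) \<phi> \<psi>"
    using pq \<phi> \<psi> cover_relation_class[OF coarse_cover_restrict[OF Z \<U>]] by simp
  then have "cover_close Y \<U> \<phi> \<psi>"
    by (rule cover_close_restrict[OF Z, rotated 3])
      (use \<U> coarse_map_submetricD(2)[OF \<phi>(1)] coarse_map_submetricD(2)[OF \<psi>(1)]
        in \<open>simp_all add: coarse_cover_def\<close>)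
  then show ?thesis
    using \<phi> \<psi> by (simp add: endpoint_map_inclusion_class cover_relation_class[OF \<U>]
        coarse_map_submetricD)
qed

lemma cover_relation_extend:
  assumes Z: "Z \<subseteq> mspace Y" and \<V>: "coarse_cover (submetric Y Z) \<V>"
  obtains \<U> where "coarse_cover Y \<U>"
    "\<And>p q. p \<in> endpoints (submetric Y Z) \<Longrightarrow> q \<in> endpoints (submetric Y Z) \<Longrightarrow>
       (endpoint_map Y id p, endpoint_map Y id q) \<in> cover_relation Y \<U> \<Longrightarrow>
       (p, q) \<in> cover_relation (submetric Y Z) \<V>"
proof (cases "Z = {}")
  case True
  \<comment> \<open>There is no map from a nonempty \<open>Y\<close> to \<open>Z\<close>, but also no endpoint: any cover of \<open>Y\<close> will do.\<close>
  have "coentourage Y {}" by (simp add: coentourage_def)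
  then have "coarse_cover Y {mspace Y}" by (simp add: coarse_cover_def)
  moreover have "endpoints (submetric Y Z) = {}"
    using coarse_map_submetricD(2) True by (fastforce elim: endpoints_cases)
  ultimately show thesis using that by blast
next
  case False
  then obtain \<pi> where "almost_nearest_point_map Y Z \<pi>"
    using almost_nearest_point_map_exists[OF Z] by blast
  then interpret almost_nearest_point_map Y Z \<pi> .
  note cov = coarse_cover_extended[OF \<V>]
  have "(p, q) \<in> cover_relation (submetric Y Z) \<V>"
    if p: "p \<in> endpoints (submetric Y Z)" and q: "q \<in> endpoints (submetric Y Z)"
      and near: "(endpoint_map Y id p, endpoint_map Y id q) \<in> cover_relation Y (extended_cover \<V>)"
    for p q
  proof -
    obtain \<phi> where \<phi>: "coarse_map nat_metric (submetric Y Z) \<phi>"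
        "p = endpoint_rel (submetric Y Z) `` {\<phi>}"
      using p by (rule endpoints_cases)
    obtain \<psi> where \<psi>: "coarse_map nat_metric (submetric Y Z) \<psi>"
        "q = endpoint_rel (submetric Y Z) `` {\<psi>}"
      using q by (rule endpoints_cases)
    have "cover_close Y (extended_cover \<V>) \<phi> \<psi>"
      using near \<phi> \<psi> by (simp add: endpoint_map_inclusion_class cover_relation_class[OF cov]
          coarse_map_submetricD)
    then have "cover_close (submetric Y Z) \<V> \<phi> \<psi>"
      using cover_close_extendedD[OF \<V>] coarse_map_submetricD(2) \<phi>(1) \<psi>(1) by blast
    then show ?thesis
      using \<phi> \<psi> by (simp add: cover_relation_class[OF \<V>])
  qed
  with cov show thesis by (rule that)
qed

theorem proposition33:
  fixes Y :: "'a metric" and Z :: "'a set"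
  assumes "Z \<subseteq> mspace Y"
  shows "uniform_embedding
           (endpoints (submetric Y Z)) (endpoint_uniformity (submetric Y Z))
           (endpoints Y) (endpoint_uniformity Y)
           (endpoint_map Y (id :: 'a \<Rightarrow> 'a))"
proof -
  let ?A = "endpoints (submetric Y Z)" and ?f = "endpoint_map Y (id :: 'a \<Rightarrow> 'a)"
  let ?\<A> = "endpoint_uniformity (submetric Y Z)"
  let ?\<B> = "subspace_uniformity (endpoint_uniformity Y) (?f ` ?A)"
  have inj: "inj_on ?f ?A" by (rule inj_on_endpoint_map_inclusion)
  have img: "?f ` ?A \<subseteq> endpoints Y" using endpoint_map_inclusion_in by blast
  have "uniformly_continuous_between ?A ?\<A> (?f ` ?A) ?\<B> ?f"
    unfolding uniformly_continuous_between_def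
  proof (intro conjI ballI order_refl)
    fix R assume "R \<in> ?\<B>"
    then obtain \<U> where \<U>: "coarse_cover Y \<U>" "cover_relation Y \<U> \<inter> ?f ` ?A \<times> ?f ` ?A \<subseteq> R"
      unfolding subspace_uniformity_def endpoint_uniformity_def by blast
    have "cover_relation (submetric Y Z) ((\<lambda>U. U \<inter> Z) ` \<U>) \<subseteq> {(p, q) \<in> ?A \<times> ?A. (?f p, ?f q) \<in> R}"
    proof clarify
      fix p q assume near: "(p, q) \<in> cover_relation (submetric Y Z) ((\<lambda>U. U \<inter> Z) ` \<U>)"
      then have "p \<in> ?A" "q \<in> ?A" by (auto simp: cover_relation_def)
      then show "(p, q) \<in> ?A \<times> ?A \<and> (?f p, ?f q) \<in> R"
        using cover_relation_restrict[OF assms \<U>(1) near] \<U>(2) by blast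
    qed
    then show "{(p, q) \<in> ?A \<times> ?A. (?f p, ?f q) \<in> R} \<in> ?\<A>"
      using coarse_cover_restrict[OF assms \<U>(1)] unfolding endpoint_uniformity_def by blast
  qed
  moreover have "uniformly_continuous_between (?f ` ?A) ?\<B> ?A ?\<A> (inv_into ?A ?f)"
    unfolding uniformly_continuous_between_def
  proof (intro conjI ballI)
    show "inv_into ?A ?f ` ?f ` ?A \<subseteq> ?A" by (auto intro: inv_into_into)
    fix R assume "R \<in> ?\<A>"
    then obtain \<V> where \<V>: "coarse_cover (submetric Y Z) \<V>" "cover_relation (submetric Y Z) \<V> \<subseteq> R"
      unfolding endpoint_uniformity_def by blast
    obtain \<U> where \<U>: "coarse_cover Y \<U>"
      "\<And>p q. p \<in> ?A \<Longrightarrow> q \<in> ?A \<Longrightarrow> (?f p, ?f q) \<in> cover_relation Y \<U> \<Longrightarrow>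
         (p, q) \<in> cover_relation (submetric Y Z) \<V>"
      using cover_relation_extend[OF assms \<V>(1)] by blast
    define R' where "R' = {(p, q) \<in> ?f ` ?A \<times> ?f ` ?A. (inv_into ?A ?f p, inv_into ?A ?f q) \<in> R}"
    have "cover_relation Y \<U> \<inter> ?f ` ?A \<times> ?f ` ?A \<subseteq> R'"
      using \<U>(2) \<V>(2) inj by (auto simp: R'_def inv_into_f_f)
    \<comment> \<open>\<open>R'\<close> is the trace on the image of the entourage \<open>cover_relation Y \<U> \<union> R'\<close>.\<close>
    moreover have R'_sub: "R' \<subseteq> ?f ` ?A \<times> ?f ` ?A" by (auto simp: R'_def)
    ultimately have "R' = (cover_relation Y \<U> \<union> R') \<inter> ?f ` ?A \<times> ?f ` ?A" by blast
    moreover have "cover_relation Y \<U> \<union> R' \<in> endpoint_uniformity Y"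
      using \<U>(1) img R'_sub unfolding endpoint_uniformity_def
      by (auto simp: cover_relation_def)
    ultimately have "R' \<in> ?\<B>" unfolding subspace_uniformity_def by (rule image_eqI)
    then show "{(p, q) \<in> ?f ` ?A \<times> ?f ` ?A. (inv_into ?A ?f p, inv_into ?A ?f q) \<in> R} \<in> ?\<B>"
      by (simp only: R'_def)
  qed
  ultimately show ?thesis
    using inj img by (simp add: uniform_embedding_def uniform_isomorphism_def bij_betw_def)
qed

end
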